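(* For any $1<p<\infty$, the class $A_p$ is strictly contained in the class $A_{p,1}$: $A_p\subsetneq A_{p,1}$.
   Context: A weight on $\mathbb{R}$ is a locally integrable, almost everywhere positive function $w$. For $1<p<\infty$, $A_p$ is the class of weights $w$ on $\mathbb{R}$ such that $$\sup_{I}\left(\frac1{|I|}\int_I w(x)\,dx\right)\left(\frac1{|I|}\int_I w(x)^{-\frac1{p-1}}\,dx\right)^{p-1}<\infty,$$ the supremum being over all bounded intervals $I\subseteq\mathbb{R}$ (of positive length). The class $A_{p,1}$ consists of the weights $w$ on $\mathbb{R}$ for which the same supremum, restricted to bounded intervals $I$ with length $|I|\ge 1$, is finite. *)

theory Defs
  imports "HOL-Analysis.Analysis"
begin

definition locally_integrable :: "(real \<Rightarrow> real) \<Rightarrow> bool" where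
  "locally_integrable f \<longleftrightarrow> (\<forall>K. compact K \<longrightarrow> f absolutely_integrable_on K)"

definition weight :: "(real \<Rightarrow> real) \<Rightarrow> bool" where
  "weight w \<longleftrightarrow> locally_integrable w \<and> (AE x in lebesgue. 0 < w x)"

(* The power x^r of an extended nonnegative real x; only used for r > 0,
   where infinity^r = infinity. *)
definition ennpowr :: "ennreal \<Rightarrow> real \<Rightarrow> ennreal" where
  "ennpowr x r = (if x = \<infinity> then \<infinity> else ennreal (enn2real x powr r))"

definition average :: "real set \<Rightarrow> (real \<Rightarrow> real) \<Rightarrow> ennreal" where
  "average I f = (\<integral>\<^sup>+x\<in>I. ennreal (f x) \<partial>lebesgue) / emeasure lebesgue I"

(* The averages are taken in [0, infinity]: w powr (-1/(p-1)) need not be locally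
   integrable for a weight w, and the quantity is then infinite on some intervals.
   The values of w on the null set where it is not positive are irrelevant. *)
definition Ap_quantity :: "real \<Rightarrow> (real \<Rightarrow> real) \<Rightarrow> real set \<Rightarrow> ennreal" where
  "Ap_quantity p w I =
     average I w * ennpowr (average I (\<lambda>x. w x powr (- (1 / (p - 1))))) (p - 1)"

definition A_class :: "real \<Rightarrow> (real \<Rightarrow> real) set" where
  "A_class p = {w. weight w \<and>
     (SUP I \<in> {I. is_interval I \<and> bounded I \<and> 0 < measure lebesgue I}. Ap_quantity p w I) < \<infinity>}"

definition A_class_large :: "real \<Rightarrow> (real \<Rightarrow> real) set" where
  "A_class_large p = {w. weight w \<and>
     (SUP I \<in> {I. is_interval I \<and> bounded I \<and> 1 \<le> measure lebesgue I}. Ap_quantity p w I) < \<infinity>}"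

end

theory Submission
  imports Defs
begin

text \<open>
  The inclusion is monotonicity of the supremum. For strictness take the weight that is \<open>1\<close>
  off \<open>(0, 1]\<close> and \<open>1 + x powr (-1/2)\<close> on \<open>(0, 1]\<close>. It is at least \<open>1\<close>, and
  its excess over \<open>1\<close> has finite integral, so both averages are bounded over intervals of length
  at least \<open>1\<close>. On \<open>[-h, h]\<close>, however, the average of the weight is at least
  \<open>h powr (-1/2) / 2\<close>, while the left half contributes \<open>1/2\<close> to that of its negative power.
\<close>

text \<open>\<open>enn2real\<close> sends infinity to 0, so it is monotone only below a finite
  bound. An infinite \<open>y\<close> is therefore treated apart, by the first branch of
  \<open>ennpowr\<close>.\<close>

lemma ennpowr_mono:
  assumes "x \<le> y" "0 < r"
  shows "ennpowr x r \<le> ennpowr y r"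
proof (cases "y = \<infinity>")
  case False
  then have "x \<noteq> \<infinity>" "enn2real x \<le> enn2real y"
    using assms(1) by (auto simp: top_unique intro: enn2real_mono simp: less_top)
  with False assms(2) show ?thesis
    by (auto simp: ennpowr_def intro!: ennreal_leI powr_mono2)
qed (simp add: ennpowr_def)

lemma ennpowr_ennreal: "0 \<le> x \<Longrightarrow> ennpowr (ennreal x) r = ennreal (x powr r)"
  by (simp add: ennpowr_def)

lemma is_interval_sets_lebesgue: "is_interval I \<Longrightarrow> I \<in> sets lebesgue" for I :: "real set"
  by (simp add: real_interval_borel_measurable)

text \<open>The part of the integral over \<open>I - A\<close> is discarded; it is nonnegative
  because \<open>ennreal\<close> truncates negative values to 0.\<close>

lemma average_ge:
  assumes "A \<subseteq> I" "A \<in> sets lebesgue" "\<And>x. x \<in> A \<Longrightarrow> c \<le> f x"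
  shows "ennreal c * emeasure lebesgue A / emeasure lebesgue I \<le> average I f"
proof -
  have "ennreal c * emeasure lebesgue A = (\<integral>\<^sup>+x. ennreal c * indicator A x \<partial>lebesgue)"
    using assms(2) by (simp add: nn_integral_cmult_indicator)
  also have "\<dots> \<le> (\<integral>\<^sup>+x\<in>I. ennreal (f x) \<partial>lebesgue)"
    using assms(1,3) by (intro nn_integral_mono) (auto simp: indicator_def intro: ennreal_leI)
  finally show ?thesis
    unfolding average_def by (rule divide_right_mono_ennreal)
qed

lemma average_le:
  assumes "I \<in> sets lebesgue" "0 < emeasure lebesgue I" "emeasure lebesgue I < \<infinity>"
    and "\<And>x. x \<in> I \<Longrightarrow> f x \<le> c"
  shows "average I f \<le> ennreal c"
proof -
  have "(\<integral>\<^sup>+x\<in>I. ennreal (f x) \<partial>lebesgue) \<le> (\<integral>\<^sup>+x. ennreal c * indicator I x \<partial>lebesgue)"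
    using assms(4) by (intro nn_integral_mono) (auto simp: indicator_def intro: ennreal_leI)
  also have "\<dots> = ennreal c * emeasure lebesgue I"
    using assms(1) by (simp add: nn_integral_cmult_indicator)
  finally have "average I f \<le> ennreal c * emeasure lebesgue I / emeasure lebesgue I"
    unfolding average_def by (rule divide_right_mono_ennreal)
  also have "\<dots> = ennreal c"
    using assms(2,3) by (intro ennreal_mult_divide_eq) auto
  finally show ?thesis .
qed

lemma A_class_subset: "A_class p \<subseteq> A_class_large p"
proof -
  have "(SUP I \<in> {I. is_interval I \<and> bounded I \<and> 1 \<le> measure lebesgue I}. Ap_quantity p w I)
      \<le> (SUP I \<in> {I. is_interval I \<and> bounded I \<and> 0 < measure lebesgue I}. Ap_quantity p w I)" for w
    by (intro SUP_subset_mono) auto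
  then show ?thesis
    unfolding A_class_def A_class_large_def by (auto intro: order.strict_trans1)
qed

text \<open>The closed interval matches the library integral of a power from 0. At the endpoint 0
  the value is 0, since \<open>0 powr r = 0\<close>.\<close>

definition bump :: "real \<Rightarrow> real" where
  "bump x = (if x \<in> {0..1} then x powr (- (1/2)) else 0)"

text \<open>The exponent -1/2 exceeds -1, so the singularity at 0 is integrable.\<close>

lemma integrable_bump: "integrable lebesgue bump"
proof -
  have "(\<lambda>x::real. x powr (- (1/2))) absolutely_integrable_on {0..1}"
    using has_integral_powr_from_0[of "- (1/2)" 1]
    by (intro nonnegative_absolutely_integrable_1) (auto simp: integrable_on_def)
  then show ?thesis
    unfolding set_integrable_def bump_def
    \<comment> \<open>Integrability on a set means integrability of the indicator times the
      function, and that product is \<open>bump\<close> pointwise.\<close>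
    by (rule Bochner_Integration.integrable_cong[THEN iffD1, rotated -1])
      (auto simp: indicator_def)
qed

lemma bump_nonneg: "0 \<le> bump x"
  by (simp add: bump_def)

lemma weight_bump: "weight (\<lambda>x. 1 + bump x)"
  unfolding weight_def locally_integrable_def
proof (intro conjI allI impI AE_I2)
  fix K :: "real set" assume K: "compact K"
  then have K': "K \<in> lmeasurable" by (rule lmeasurable_compact)
  have "bump absolutely_integrable_on K"
    unfolding set_integrable_def
    using K' by (intro integrable_mult_indicator integrable_bump) (auto simp: fmeasurable_def)
  moreover have "(\<lambda>x::real. 1::real) absolutely_integrable_on K"
    using K' by simp
  ultimately show "(\<lambda>x. 1 + bump x) absolutely_integrable_on K"
    by (intro set_integral_add)
next
  fix x show "0 < 1 + bump x" using bump_nonneg[of x] by simp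
qed

lemma Ap_quantity_bump_le:
  assumes "1 < p" "is_interval I" "bounded I" "1 \<le> measure lebesgue I"
  shows "Ap_quantity p (\<lambda>x. 1 + bump x) I \<le> 1 + (\<integral>\<^sup>+x. ennreal (bump x) \<partial>lebesgue)"
proof -
  let ?C = "\<integral>\<^sup>+x. ennreal (bump x) \<partial>lebesgue"
  have I: "I \<in> sets lebesgue" by (rule is_interval_sets_lebesgue[OF assms(2)])
  have fin: "emeasure lebesgue I < \<infinity>"
    using fmeasurableD2[OF bounded_set_imp_lmeasurable[OF assms(3) I]] by (simp add: less_top)
  then have one: "1 \<le> emeasure lebesgue I"
    using assms(4) by (subst emeasure_eq_ennreal_measure) auto
  then have pos: "0 < emeasure lebesgue I" by (rule less_le_trans[rotated]) simp
  have meas: "(\<lambda>x. ennreal (bump x)) \<in> borel_measurable lebesgue"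
    using integrable_bump by (auto dest: borel_measurable_integrable)
  have "(\<integral>\<^sup>+x\<in>I. ennreal (1 + bump x) \<partial>lebesgue)
      \<le> (\<integral>\<^sup>+x. indicator I x + ennreal (bump x) \<partial>lebesgue)"
    using bump_nonneg by (intro nn_integral_mono) (auto simp: indicator_def ennreal_plus)
  also have "\<dots> = emeasure lebesgue I + ?C"
    using I meas by (subst nn_integral_add) auto
  finally have "average I (\<lambda>x. 1 + bump x) \<le> (emeasure lebesgue I + ?C) / emeasure lebesgue I"
    unfolding average_def by (rule divide_right_mono_ennreal)
  also have "\<dots> = 1 + ?C / emeasure lebesgue I"
    using ennreal_mult_divide_eq[of "emeasure lebesgue I" 1] pos fin
    by (simp add: add_divide_distrib_ennreal)
  \<comment> \<open>Length at least 1 enters here: enlarging the numerator by the factor |I| lets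
    the length cancel, leaving a bound independent of \<open>I\<close>.\<close>
  also have "?C / emeasure lebesgue I \<le> ?C * emeasure lebesgue I / emeasure lebesgue I"
    using mult_left_mono[OF one, of ?C] by (intro divide_right_mono_ennreal) simp
  also have "\<dots> = ?C"
    using pos fin by (intro ennreal_mult_divide_eq) auto
  finally have avg1: "average I (\<lambda>x. 1 + bump x) \<le> 1 + ?C" by (simp add: add_left_mono)
  have "average I (\<lambda>x. (1 + bump x) powr (- (1 / (p - 1)))) \<le> ennreal 1"
  proof (intro average_le I pos fin)
    show "(1 + bump x) powr (- (1 / (p - 1))) \<le> 1" for x
      using assms(1) bump_nonneg[of x] powr_mono[of "- (1 / (p - 1))" 0 "1 + bump x"] by simp
  qed
  then have "ennpowr (average I (\<lambda>x. (1 + bump x) powr (- (1 / (p - 1))))) (p - 1)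
      \<le> ennpowr 1 (p - 1)"
    using assms(1) by (intro ennpowr_mono) auto
  also have "\<dots> = 1" by (simp add: ennpowr_def)
  finally show ?thesis
    unfolding Ap_quantity_def using mult_mono[OF avg1] by fastforce
qed

text \<open>Each half of the interval serves one average, which costs a factor 1/2 each time. As
  \<open>h\<close> tends to 0 the first factor blows up while \<open>(1/2) powr (p - 1)\<close>
  stays fixed.\<close>

lemma Ap_quantity_bump_ge:
  assumes "1 < p" "0 < h" "h \<le> 1"
  shows "ennreal (h powr (- (1/2)) / 2 * (1/2) powr (p - 1))
    \<le> Ap_quantity p (\<lambda>x. 1 + bump x) {-h..h}"
proof -
  \<comment> \<open>The point 0 is left out because \<open>bump\<close> vanishes there;
    \<open>h \<le> 1\<close> keeps the right half inside the region where \<open>bump\<close> is the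
    power.\<close>
  have "ennreal (h powr (- (1/2))) * emeasure lebesgue {0<..h} / emeasure lebesgue {-h..h}
      \<le> average {-h..h} (\<lambda>x. 1 + bump x)"
  proof (intro average_ge)
    fix x assume x: "x \<in> {0<..h}"
    then have "h powr (- (1/2)) \<le> x powr (- (1/2))"
      by (intro powr_mono2') auto
    then show "h powr (- (1/2)) \<le> 1 + bump x"
      using x assms(3) by (simp add: bump_def)
  qed (use assms(2) in auto)
  then have avg1: "ennreal (h powr (- (1/2)) / 2) \<le> average {-h..h} (\<lambda>x. 1 + bump x)"
    using assms(2) by (simp add: divide_ennreal flip: ennreal_mult)
  \<comment> \<open>To the left of 0 the weight is 1, hence so is its negative power.\<close>
  have "ennreal 1 * emeasure lebesgue {-h..<0} / emeasure lebesgue {-h..h}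
      \<le> average {-h..h} (\<lambda>x. (1 + bump x) powr (- (1 / (p - 1))))"
    by (intro average_ge) (use assms(2) in \<open>auto simp: bump_def\<close>)
  then have "ennreal (1/2) \<le> average {-h..h} (\<lambda>x. (1 + bump x) powr (- (1 / (p - 1))))"
    using assms(2) by (simp add: divide_ennreal)
  then have "ennpowr (ennreal (1/2)) (p - 1)
      \<le> ennpowr (average {-h..h} (\<lambda>x. (1 + bump x) powr (- (1 / (p - 1))))) (p - 1)"
    using assms(1) by (intro ennpowr_mono) auto
  then have "ennreal ((1/2) powr (p - 1))
      \<le> ennpowr (average {-h..h} (\<lambda>x. (1 + bump x) powr (- (1 / (p - 1))))) (p - 1)"
    by (subst (asm) ennpowr_ennreal) auto
  from mult_mono[OF avg1 this] show ?thesis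
    unfolding Ap_quantity_def by (subst ennreal_mult) auto
qed

lemma bump_in_A_class_large:
  assumes "1 < p"
  shows "(\<lambda>x. 1 + bump x) \<in> A_class_large p"
proof -
  have "(\<integral>\<^sup>+x. ennreal (bump x) \<partial>lebesgue) < \<infinity>"
    using integrable_bump bump_nonneg by (simp add: integrable_iff_bounded)
  then have "1 + (\<integral>\<^sup>+x. ennreal (bump x) \<partial>lebesgue) < \<infinity>"
    by (simp add: ennreal_add_less_top)
  moreover have "(SUP I \<in> {I. is_interval I \<and> bounded I \<and> 1 \<le> measure lebesgue I}.
      Ap_quantity p (\<lambda>x. 1 + bump x) I) \<le> 1 + (\<integral>\<^sup>+x. ennreal (bump x) \<partial>lebesgue)"
    using Ap_quantity_bump_le[OF assms] by (intro SUP_least) auto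
  ultimately show ?thesis
    unfolding A_class_large_def using weight_bump by (auto intro: order.strict_trans1)
qed

lemma bump_not_in_A_class:
  assumes "1 < p"
  shows "(\<lambda>x. 1 + bump x) \<notin> A_class p"
proof
  let ?S = "SUP I \<in> {I. is_interval I \<and> bounded I \<and> 0 < measure lebesgue I}.
      Ap_quantity p (\<lambda>x. 1 + bump x) I"
  let ?k = "(1/2) powr (p - 1) / 2 :: real"
  assume "(\<lambda>x. 1 + bump x) \<in> A_class p"
  then have "?S < top" by (simp add: A_class_def)
  then obtain M where M: "?S = ennreal M" "0 \<le> M"
    by (cases ?S rule: ennreal_cases) auto
  obtain n :: nat where n: "M / ?k < real n" using reals_Archimedean2 by blast
  \<comment> \<open>The added 1 yields \<open>1 \<le> m\<close>, which makes the half-length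
    \<open>?h\<close> at most 1.\<close>
  define m where "m = real n + 1"
  have m: "1 \<le> m" "M < m * ?k" using n by (auto simp: m_def field_simps intro: less_trans)
  \<comment> \<open>Chosen so that \<open>?h powr (- (1/2))\<close> is exactly \<open>m\<close>: the
    lower bound becomes \<open>m * ?k\<close>, which exceeds the supposed supremum
    \<open>M\<close>.\<close>
  let ?h = "m powr (-2)"
  have h: "0 < ?h" "?h \<le> 1"
    using m by (auto simp: powr_minus_divide)
  have "?h powr (- (1/2)) = m" using m by (simp add: powr_powr)
  then have "ennreal (m * ?k) \<le> Ap_quantity p (\<lambda>x. 1 + bump x) {-?h..?h}"
    using Ap_quantity_bump_ge[OF assms h] by (simp add: mult.commute)
  also have "\<dots> \<le> ?S"
    using h by (intro SUP_upper) (auto simp: is_interval_cc)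
  finally have "ennreal (m * ?k) \<le> ennreal M" by (simp add: M)
  with m M(2) show False by (simp add: ennreal_le_iff)
qed

theorem proposition3p11:
  fixes p :: real
  assumes "1 < p"
  shows "A_class p \<subset> A_class_large p"
  using A_class_subset bump_in_A_class_large[OF assms] bump_not_in_A_class[OF assms] by blast

end
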